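(* (i) For all integers $n\geq r\geq1$, $J_n^{(r)}(q)$ is a monic polynomial in $q$ all of whose coefficients are nonnegative integers, with constant term $(n-r)!$ and degree $\binom{n-1}{2}-\binom{r-1}{2}$; moreover $J_r^{(r)}=1$ for all $r\geq1$. (ii) For all integers $n,r$ with $n-1\geq r\geq1$, $$J_n^{(r)}(q)=\sum_{j=1}^{n-r}[r]_q^{\,j}\,q^{\binom{j}{2}}\binom{n-r}{j}J_{n-r}^{(j)}(q).$$
   Context: Let $\Lambda$ be the ring of symmetric functions in infinitely many variables with coefficients in $\mathbb{Q}(q)$; $e_n$ are the elementary symmetric functions and $m_\lambda$ the monomial symmetric functions. For $n\geq r\geq1$, $p_n^{(r)}=\sum m_\lambda$ over all partitions $\lambda$ of $n$ with exactly $r$ parts. Let $\varphi:\Lambda\to\mathbb{Q}(q)$ be the unique $\mathbb{Q}(q)$-algebra homomorphism with $\varphi(e_n)=q^{\binom n2}/n!$ for $n\geq1$ (specialization of $\sum e_nt^n$ to $E_{xp}(t)=\sum_{n\geq0}q^{\binom n2}t^n/n!$). For $n\geq r\geq1$ define $J_n^{(r)}(q)\in\mathbb{Q}(q)$ by $\varphi(p_n^{(r)})=(1-q)^{n-r}\frac{q^{\binom r2}}{r!\,(n-r)!}J_n^{(r)}(q)$. For $k\geq1$, $[k]_q=1+q+\dots+q^{k-1}$. *)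

theory Defs
  imports
    "HOL-Library.Poly_Mapping"
    "HOL-Library.Multiset"
    "HOL-Computational_Algebra.Computational_Algebra"
begin

text \<open>A monomial is identified with its finitely supported exponent vector.\<close>

type_synonym monomial = "nat \<Rightarrow>\<^sub>0 nat"

definition exponents :: "monomial \<Rightarrow> nat multiset" where
  "exponents x = image_mset (Poly_Mapping.lookup x) (mset_set (Poly_Mapping.keys x))"

definition total_degree :: "monomial \<Rightarrow> nat" where
  "total_degree x = (\<Sum>i\<in>Poly_Mapping.keys x. Poly_Mapping.lookup x i)"

lemma sum_mset_exponents: "sum_mset (exponents x) = total_degree x"
  by (simp add: exponents_def total_degree_def sum_unfold_sum_mset)

lemma total_degree_superset:
  assumes "finite A" "Poly_Mapping.keys x \<subseteq> A"
  shows "total_degree x = (\<Sum>i\<in>A. Poly_Mapping.lookup x i)"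
  unfolding total_degree_def using assms
  by (intro sum.mono_neutral_left) (auto simp: in_keys_iff)

lemma total_degree_zero [simp]: "total_degree 0 = 0"
  by (simp add: total_degree_def)

lemma total_degree_add: "total_degree (x + y) = total_degree x + total_degree y"
proof -
  let ?A = "Poly_Mapping.keys x \<union> Poly_Mapping.keys y"
  have "total_degree (x + y) = (\<Sum>i\<in>?A. Poly_Mapping.lookup (x + y) i)"
    by (rule total_degree_superset) (use Poly_Mapping.keys_add[of x y] in auto)
  moreover have "total_degree x = (\<Sum>i\<in>?A. Poly_Mapping.lookup x i)"
    by (rule total_degree_superset) auto
  moreover have "total_degree y = (\<Sum>i\<in>?A. Poly_Mapping.lookup y i)"
    by (rule total_degree_superset) auto
  ultimately show ?thesis by (simp add: lookup_add sum.distrib)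
qed

lemma bij_betw_keys_map_key:
  assumes "bij \<pi>"
  shows "bij_betw \<pi> (Poly_Mapping.keys (Poly_Mapping.map_key \<pi> x)) (Poly_Mapping.keys x)"
  using assms keys_map_key[OF bij_is_inj[OF assms], of x]
  by (auto simp: bij_betw_def inj_on_def bij_def surj_image_vimage_eq)

lemma exponents_map_key:
  assumes "bij \<pi>"
  shows "exponents (Poly_Mapping.map_key \<pi> x) = exponents x"
proof -
  let ?K = "Poly_Mapping.keys (Poly_Mapping.map_key \<pi> x)"
  have lk: "Poly_Mapping.lookup (Poly_Mapping.map_key \<pi> x) = Poly_Mapping.lookup x \<circ> \<pi>"
    using assms by (auto simp: bij_def map_key.rep_eq)
  have "exponents (Poly_Mapping.map_key \<pi> x) =
      image_mset (Poly_Mapping.lookup x) (image_mset \<pi> (mset_set ?K))"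
    by (simp add: exponents_def lk multiset.map_comp)
  also have "image_mset \<pi> (mset_set ?K) = mset_set (Poly_Mapping.keys x)"
    using bij_betw_keys_map_key[OF assms, of x]
    by (metis bij_betw_def image_mset_mset_set)
  finally show ?thesis by (simp add: exponents_def)
qed

lemma total_degree_map_key:
  "bij \<pi> \<Longrightarrow> total_degree (Poly_Mapping.map_key \<pi> x) = total_degree x"
  by (metis exponents_map_key sum_mset_exponents)

lemma map_key_eq_0_iff:
  "bij \<pi> \<Longrightarrow> Poly_Mapping.map_key \<pi> (x :: monomial) = 0 \<longleftrightarrow> x = 0"
proof -
  assume b: "bij \<pi>"
  have "Poly_Mapping.keys (Poly_Mapping.map_key \<pi> x) = {} \<longleftrightarrow> Poly_Mapping.keys x = {}"
    using bij_betw_keys_map_key[OF b, of x] by (metis bij_betw_def image_is_empty)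
  then show ?thesis by (metis keys_eq_empty)
qed

definition splittings :: "monomial \<Rightarrow> (monomial \<times> monomial) set" where
  "splittings x = {(a, b). a + b = x}"

lemma finite_splittings: "finite (splittings x)"
proof -
  let ?K = "Poly_Mapping.keys x"
  let ?r = "\<lambda>(a :: monomial, b :: monomial). restrict (Poly_Mapping.lookup a) ?K"
  have sub: "Poly_Mapping.keys a \<subseteq> ?K" "\<forall>i. Poly_Mapping.lookup a i \<le> Poly_Mapping.lookup x i"
    if "a + b = x" for a b
    using that by (auto simp: lookup_add in_keys_iff)
  have "?r ` splittings x \<subseteq> (\<Pi>\<^sub>E i\<in>?K. {..Poly_Mapping.lookup x i})"
    using sub by (auto simp: splittings_def)
  then have "finite (?r ` splittings x)"
    by (rule finite_subset) (auto intro: finite_PiE)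
  moreover have "inj_on ?r (splittings x)"
  proof (rule inj_onI, clarify)
    fix a b c d
    assume ab: "(a, b) \<in> splittings x" and cd: "(c, d) \<in> splittings x"
      and eq: "restrict (Poly_Mapping.lookup a) ?K = restrict (Poly_Mapping.lookup c) ?K"
    have "Poly_Mapping.lookup a i = Poly_Mapping.lookup c i" for i
    proof (cases "i \<in> ?K")
      case True then show ?thesis using eq by (metis restrict_apply')
    next
      case False
      have "Poly_Mapping.keys a \<subseteq> ?K" "Poly_Mapping.keys c \<subseteq> ?K"
        using sub(1) ab cd by (auto simp: splittings_def)
      with False show ?thesis by (metis in_keys_iff subsetD)
    qed
    then have "a = c" by (rule poly_mapping_eqI)
    with ab cd show "a = c \<and> b = d" by (auto simp: splittings_def)
  qed
  ultimately show ?thesis by (rule finite_imageD)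
qed


text \<open>
  A symmetric function is a formal power series of bounded degree in countably many
  variables, given by its coefficient function, that is invariant under all permutations
  of the variables.
\<close>

typedef (overloaded) 'a symfun =
  "{f :: monomial \<Rightarrow> 'a::zero.
      (\<forall>\<pi> x. bij \<pi> \<longrightarrow> f (Poly_Mapping.map_key \<pi> x) = f x) \<and>
      (\<exists>d. \<forall>x. f x \<noteq> 0 \<longrightarrow> total_degree x \<le> d)}"
  morphisms sf_coeff Abs_symfun
  by (rule exI[of _ "\<lambda>_. 0"]) auto

setup_lifting type_definition_symfun

lemma symfun_eqI: "(\<And>x. sf_coeff f x = sf_coeff g x) \<Longrightarrow> f = g"
  by (metis ext sf_coeff_inject)

lemma bij_betw_splittings_map_key:
  assumes "bij \<pi>"
  shows "bij_betw (map_prod (Poly_Mapping.map_key \<pi>) (Poly_Mapping.map_key \<pi>))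
           (splittings x) (splittings (Poly_Mapping.map_key \<pi> x))"
proof -
  let ?i = "inv \<pi>"
  have inj: "inj \<pi>" "inj ?i" using assms by (auto simp: bij_def inj_imp_inv_eq surj_imp_inj_inv)
  have c1: "Poly_Mapping.map_key ?i (Poly_Mapping.map_key \<pi> y) = y" for y :: monomial
    using assms inj by (simp add: map_key_compose surj_iff[THEN iffD1] bij_def map_key_id[unfolded id_def[symmetric]])
  have c2: "Poly_Mapping.map_key \<pi> (Poly_Mapping.map_key ?i y) = y" for y :: monomial
    using assms inj by (simp add: map_key_compose inj_iff[THEN iffD1] bij_def map_key_id[unfolded id_def[symmetric]])
  show ?thesis
    by (rule bij_betw_byWitness[where f' = "map_prod (Poly_Mapping.map_key ?i) (Poly_Mapping.map_key ?i)"])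
      (auto simp: splittings_def c1 c2 map_key_plus[symmetric] inj)
qed

instantiation symfun :: (comm_ring_1) comm_ring_1
begin

lift_definition zero_symfun :: "'a symfun" is "\<lambda>_. 0"
  by auto

lift_definition one_symfun :: "'a symfun" is "\<lambda>x. if x = 0 then 1 else 0"
  by (auto simp: map_key_eq_0_iff)

lift_definition plus_symfun :: "'a symfun \<Rightarrow> 'a symfun \<Rightarrow> 'a symfun"
  is "\<lambda>f g x. f x + g x"
proof (intro CollectI conjI; elim CollectE conjE)
  fix f g :: "monomial \<Rightarrow> 'a"
  assume "\<exists>d. \<forall>x. f x \<noteq> 0 \<longrightarrow> total_degree x \<le> d" "\<exists>d. \<forall>x. g x \<noteq> 0 \<longrightarrow> total_degree x \<le> d"
  then obtain d e where "\<forall>x. f x \<noteq> 0 \<longrightarrow> total_degree x \<le> d" "\<forall>x. g x \<noteq> 0 \<longrightarrow> total_degree x \<le> e"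
    by blast
  then have "\<forall>x. f x + g x \<noteq> 0 \<longrightarrow> total_degree x \<le> max d e"
    by (metis add.right_neutral max.coboundedI1 max.coboundedI2)
  then show "\<exists>d. \<forall>x. f x + g x \<noteq> 0 \<longrightarrow> total_degree x \<le> d" by blast
qed auto

lift_definition uminus_symfun :: "'a symfun \<Rightarrow> 'a symfun" is "\<lambda>f x. - f x"
  by auto

lift_definition minus_symfun :: "'a symfun \<Rightarrow> 'a symfun \<Rightarrow> 'a symfun"
  is "\<lambda>f g x. f x - g x"
proof (intro CollectI conjI; elim CollectE conjE)
  fix f g :: "monomial \<Rightarrow> 'a"
  assume "\<exists>d. \<forall>x. f x \<noteq> 0 \<longrightarrow> total_degree x \<le> d" "\<exists>d. \<forall>x. g x \<noteq> 0 \<longrightarrow> total_degree x \<le> d"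
  then obtain d e where "\<forall>x. f x \<noteq> 0 \<longrightarrow> total_degree x \<le> d" "\<forall>x. g x \<noteq> 0 \<longrightarrow> total_degree x \<le> e"
    by blast
  then have "\<forall>x. f x - g x \<noteq> 0 \<longrightarrow> total_degree x \<le> max d e"
    by (metis diff_zero max.coboundedI1 max.coboundedI2)
  then show "\<exists>d. \<forall>x. f x - g x \<noteq> 0 \<longrightarrow> total_degree x \<le> d" by blast
qed auto

lift_definition times_symfun :: "'a symfun \<Rightarrow> 'a symfun \<Rightarrow> 'a symfun"
  is "\<lambda>f g x. \<Sum>(a, b)\<in>splittings x. f a * g b"
proof (intro CollectI conjI; elim CollectE conjE)
  fix f g :: "monomial \<Rightarrow> 'a"
  assume "\<exists>d. \<forall>x. f x \<noteq> 0 \<longrightarrow> total_degree x \<le> d" "\<exists>d. \<forall>x. g x \<noteq> 0 \<longrightarrow> total_degree x \<le> d"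
  then obtain d e where d: "\<forall>x. f x \<noteq> 0 \<longrightarrow> total_degree x \<le> d"
    and e: "\<forall>x. g x \<noteq> 0 \<longrightarrow> total_degree x \<le> e"
    by blast
  have "total_degree x \<le> d + e" if nz: "(\<Sum>(a, b)\<in>splittings x. f a * g b) \<noteq> 0" for x
  proof -
    obtain a b where ab: "a + b = x" "f a * g b \<noteq> 0"
      using nz by (auto simp: splittings_def elim!: sum.not_neutral_contains_not_neutral)
    then have "f a \<noteq> 0" "g b \<noteq> 0" by auto
    then have "total_degree a \<le> d" "total_degree b \<le> e" using d e by auto
    with ab show ?thesis by (auto simp: total_degree_add)
  qed
  then show "\<exists>d. \<forall>x. (\<Sum>(a, b)\<in>splittings x. f a * g b) \<noteq> 0 \<longrightarrow> total_degree x \<le> d" by blast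
next
  fix f g :: "monomial \<Rightarrow> 'a"
  assume f: "\<forall>\<pi> x. bij \<pi> \<longrightarrow> f (Poly_Mapping.map_key \<pi> x) = f x"
    and g: "\<forall>\<pi> x. bij \<pi> \<longrightarrow> g (Poly_Mapping.map_key \<pi> x) = g x"
  show "\<forall>\<pi> x. bij \<pi> \<longrightarrow> (\<Sum>(a, b)\<in>splittings (Poly_Mapping.map_key \<pi> x). f a * g b)
      = (\<Sum>(a, b)\<in>splittings x. f a * g b)"
  proof (intro allI impI)
    fix \<pi> :: "nat \<Rightarrow> nat" and x assume b: "bij \<pi>"
    show "(\<Sum>(a, b)\<in>splittings (Poly_Mapping.map_key \<pi> x). f a * g b)
      = (\<Sum>(a, b)\<in>splittings x. f a * g b)"
      using f g b
      by (subst sum.reindex_bij_betw[OF bij_betw_splittings_map_key[OF b], symmetric])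
        (auto intro!: sum.cong)
  qed
qed

instance
proof
  fix f g h :: "'a symfun"
  show "f + g + h = f + (g + h)" by transfer (simp add: add.assoc)
  show "f + g = g + f" by transfer (simp add: add.commute)
  show "0 + f = f" by transfer simp
  show "- f + f = 0" by transfer simp
  show "f - g = f + - g" by transfer simp
  show "(0 :: 'a symfun) \<noteq> 1" by transfer (auto dest: fun_cong[of _ _ 0])
  show "f * g = g * f"
  proof (transfer, rule ext)
    fix f g :: "monomial \<Rightarrow> 'a" and x
    have "bij_betw prod.swap (splittings x) (splittings x)"
      by (rule bij_betw_byWitness[where f' = prod.swap]) (auto simp: splittings_def add.commute)
    from sum.reindex_bij_betw[OF this, of "\<lambda>(a, b). f a * g b", symmetric]
    show "(\<Sum>(a, b)\<in>splittings x. f a * g b) = (\<Sum>(a, b)\<in>splittings x. g a * f b)"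
      by (simp add: case_prod_unfold mult.commute)
  qed
  show "(f + g) * h = f * h + g * h"
    by transfer (simp add: case_prod_unfold distrib_right sum.distrib)
  show "1 * f = f"
  proof (transfer, rule ext)
    fix f :: "monomial \<Rightarrow> 'a" and x
    have "(\<Sum>(a, b)\<in>splittings x. (if a = 0 then 1 else 0) * f b)
        = (\<Sum>(a, b)\<in>{(0 :: monomial, x)}. (if a = 0 then 1 else 0) * f b)"
      by (rule sum.mono_neutral_right) (auto simp: finite_splittings, auto simp: splittings_def split: if_splits)
    then show "(\<Sum>(a, b)\<in>splittings x. (if a = 0 then 1 else 0) * f b) = f x" by simp
  qed
  show "f * g * h = f * (g * h)"
  proof (transfer, rule ext)
    fix f g h :: "monomial \<Rightarrow> 'a" and x
    have "(\<Sum>(a, c)\<in>splittings x. (\<Sum>(a, b)\<in>splittings a. f a * g b) * h c)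
      = (\<Sum>((p, c), (a, b))\<in>(SIGMA (p, c):splittings x. splittings p). f a * g b * h c)"
      by (simp add: sum.Sigma finite_splittings case_prod_unfold sum_distrib_right)
    also have "\<dots> = (\<Sum>((a, p), (b, c))\<in>(SIGMA (a, p):splittings x. splittings p). f a * g b * h c)"
      by (rule sum.reindex_bij_witness[where
            i = "\<lambda>((a, p), (b, c)). ((a + b, c), (a, b))" and
            j = "\<lambda>((p, c), (a, b)). ((a, b + c), (b, c))"])
        (auto simp: splittings_def add.assoc)
    also have "\<dots> = (\<Sum>(a, p)\<in>splittings x. f a * (\<Sum>(b, c)\<in>splittings p. g b * h c))"
      by (simp add: sum.Sigma finite_splittings case_prod_unfold sum_distrib_left mult.assoc)
    finally show "(\<Sum>(a, c)\<in>splittings x. (\<Sum>(a, b)\<in>splittings a. f a * g b) * h c)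
      = (\<Sum>(a, p)\<in>splittings x. f a * (\<Sum>(b, c)\<in>splittings p. g b * h c))" .
  qed
qed

end

lift_definition sf_scale :: "'a::comm_ring_1 \<Rightarrow> 'a symfun \<Rightarrow> 'a symfun"
  is "\<lambda>c f x. c * f x"
  by (auto, metis mult_zero_right)

definition sf_algebra_hom :: "('a::comm_ring_1 symfun \<Rightarrow> 'a) \<Rightarrow> bool" where
  "sf_algebra_hom \<phi> \<longleftrightarrow>
     (\<forall>f g. \<phi> (f + g) = \<phi> f + \<phi> g) \<and>
     (\<forall>f g. \<phi> (f * g) = \<phi> f * \<phi> g) \<and>
     \<phi> 1 = 1 \<and>
     (\<forall>c f. \<phi> (sf_scale c f) = c * \<phi> f)"


lemma lookup_map_key_le_1:
  assumes "bij \<pi>"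
  shows "(\<forall>i. Poly_Mapping.lookup (Poly_Mapping.map_key \<pi> x) i \<le> Suc 0)
      \<longleftrightarrow> (\<forall>i. Poly_Mapping.lookup x i \<le> Suc 0)"
  using assms by (metis bij_def bij_is_inj comp_apply map_key.rep_eq surj_def)

text \<open>Elementary: the sum of all squarefree monomials of degree \<open>n\<close>.\<close>

lift_definition sf_elementary :: "nat \<Rightarrow> 'a::comm_ring_1 symfun"
  is "\<lambda>n x. if total_degree x = n \<and> (\<forall>i. Poly_Mapping.lookup x i \<le> 1) then 1 else 0"
  by (auto simp: total_degree_map_key lookup_map_key_le_1)

text \<open>
  Monomial: the sum of all monomials whose nonzero exponents, with multiplicity, are the
  parts of the partition \<open>\<mu>\<close>.
\<close>

lift_definition sf_monomial :: "nat multiset \<Rightarrow> 'a::comm_ring_1 symfun"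
  is "\<lambda>\<mu> x. if exponents x = \<mu> then 1 else 0"
  by (auto simp: exponents_map_key sum_mset_exponents[symmetric])

definition partitions_with_parts :: "nat \<Rightarrow> nat \<Rightarrow> nat multiset set" where
  "partitions_with_parts n r = {\<mu>. 0 \<notin># \<mu> \<and> sum_mset \<mu> = n \<and> size \<mu> = r}"

lemma finite_partitions_with_parts: "finite (partitions_with_parts n r)"
proof (rule finite_subset)
  have le: "x \<le> sum_mset \<mu>" if "x \<in># \<mu>" for x and \<mu> :: "nat multiset"
    using that by (metis le_add1 sum_mset.remove)
  show "partitions_with_parts n r \<subseteq> mset ` {xs. set xs \<subseteq> {..n} \<and> length xs = r}"
  proof
    fix \<mu> assume m: "\<mu> \<in> partitions_with_parts n r"
    obtain xs where "mset xs = \<mu>" using ex_mset by blast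
    with m show "\<mu> \<in> mset ` {xs. set xs \<subseteq> {..n} \<and> length xs = r}"
      by (intro image_eqI[of _ _ xs]) (auto simp: partitions_with_parts_def intro!: le)
  qed
  show "finite (mset ` {xs. set xs \<subseteq> {..n} \<and> length xs = r})"
    by (intro finite_imageI finite_lists_length_eq) simp
qed

definition sf_p :: "nat \<Rightarrow> nat \<Rightarrow> 'a::comm_ring_1 symfun" where
  "sf_p n r = (\<Sum>\<mu>\<in>partitions_with_parts n r. sf_monomial \<mu>)"


type_synonym ratfun = "rat poly fract"

definition q :: ratfun where
  "q = to_fract [:0, 1:]"

definition q_int :: "nat \<Rightarrow> ratfun" where
  "q_int k = (\<Sum>i<k. q ^ i)"

end

theory Submission
  imports Defs
begin

text \<open>
  Let \<open>E(t) = \<Sum>\<^sub>n e\<^sub>n t\<^sup>n\<close>. Expanding \<open>\<Prod>\<^sub>i (1 + u x\<^sub>i t / (1 - x\<^sub>i t))\<close> gives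
  \<open>\<Sum> p\<^sub>n\<^bsup>(r)\<^esup> t\<^sup>n u\<^sup>r = E((u - 1) t) / E(-t)\<close>. Let \<open>F\<close> be the specialization of \<open>E\<close>, which
  satisfies \<open>F'(t) = F(q t)\<close>. The coefficient of \<open>u\<^sup>r\<close> in \<open>F((u - 1) t) / F(-t)\<close> is then
  \<open>q\<^bsup>r choose 2\<^esup> t\<^sup>r / r!\<close> times \<open>F(-q\<^sup>r t) / F(-t)\<close>, and the last quotient is the same generating
  function at \<open>u = 1 - q\<^sup>r = (1 - q) [r]\<^sub>q\<close>. Comparing coefficients of \<open>t\<close> gives the
  recurrence (ii). Part (i) follows from it by induction on \<open>n - r\<close>: the summand \<open>j = n - r\<close> is
  monic and has strictly largest degree, and only \<open>j = 1\<close> contributes to the constant term.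
\<close>

section \<open>Coefficients of \<open>sf_elementary\<close> and \<open>sf_p\<close>\<close>

lemma sf_coeff_sum: "sf_coeff (sum f A) x = (\<Sum>a\<in>A. sf_coeff (f a) x)"
  by (induction A rule: infinite_finite_induct) (simp_all add: zero_symfun.rep_eq plus_symfun.rep_eq)

lemma sf_coeff_elementary:
  "sf_coeff (sf_elementary n) x =
     (if total_degree x = n \<and> (\<forall>i. Poly_Mapping.lookup x i \<le> 1) then 1 else 0)"
  by (simp add: sf_elementary.rep_eq)

text \<open>A monomial \<open>x\<close> occurs in \<open>sf_monomial \<mu>\<close> for exactly one
  \<open>\<mu>\<close>, namely \<open>exponents x\<close>, so the sum over partitions collapses to a
  membership test.\<close>

lemma sf_coeff_p:
  "sf_coeff (sf_p n r) x = (if total_degree x = n \<and> card (Poly_Mapping.keys x) = r then 1 else 0)"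
proof -
  have "exponents x \<in> partitions_with_parts n r \<longleftrightarrow> total_degree x = n \<and> card (Poly_Mapping.keys x) = r"
    by (auto simp: partitions_with_parts_def sum_mset_exponents) (auto simp: exponents_def in_keys_iff)
  then show ?thesis
    by (simp add: sf_p_def sf_coeff_sum sf_monomial.rep_eq finite_partitions_with_parts)
qed

section \<open>Squarefree monomials as finite sets of variables\<close>

definition squarefree_monomial :: "nat set \<Rightarrow> monomial" where
  "squarefree_monomial S = (\<Sum>i\<in>S. Poly_Mapping.single i 1)"

lemma lookup_squarefree_monomial:
  "finite S \<Longrightarrow> Poly_Mapping.lookup (squarefree_monomial S) i = (if i \<in> S then 1 else 0)"
  by (simp add: squarefree_monomial_def lookup_sum lookup_single when_def)

lemma keys_squarefree_monomial: "finite S \<Longrightarrow> Poly_Mapping.keys (squarefree_monomial S) = S"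
  by (auto simp: in_keys_iff lookup_squarefree_monomial split: if_splits)

lemma total_degree_squarefree_monomial: "finite S \<Longrightarrow> total_degree (squarefree_monomial S) = card S"
  by (simp add: total_degree_def keys_squarefree_monomial lookup_squarefree_monomial)

lemma squarefree_monomial_keys:
  assumes "\<forall>i. Poly_Mapping.lookup a i \<le> 1"
  shows "squarefree_monomial (Poly_Mapping.keys a) = a"
proof (rule poly_mapping_eqI)
  fix i
  have "Poly_Mapping.lookup a i \<le> 1" using assms by blast
  then show "Poly_Mapping.lookup (squarefree_monomial (Poly_Mapping.keys a)) i = Poly_Mapping.lookup a i"
    by (auto simp: lookup_squarefree_monomial in_keys_iff)
qed

lemma squarefree_monomial_plus_minus:
  assumes "S \<subseteq> Poly_Mapping.keys x"
  shows "squarefree_monomial S + (x - squarefree_monomial S) = x"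
proof -
  have "finite S" by (rule finite_subset[OF assms finite_keys])
  with assms show ?thesis
    by (intro poly_mapping_eqI) (auto simp: lookup_add lookup_minus lookup_squarefree_monomial in_keys_iff)
qed

text \<open>A squarefree left factor is determined by its support, and every subset of the support
  of \<open>x\<close> occurs. The subtraction on exponents is truncated, but exact for such
  subsets.\<close>

lemma sum_splittings_squarefree:
  "(\<Sum>(a, b)\<in>{(a, b) \<in> splittings x. \<forall>i. Poly_Mapping.lookup a i \<le> 1}. g a b) =
   (\<Sum>S\<in>Pow (Poly_Mapping.keys x). g (squarefree_monomial S) (x - squarefree_monomial S))"
proof (rule sum.reindex_bij_witness[where
      j = "\<lambda>(a, b). Poly_Mapping.keys a" and
      i = "\<lambda>S. (squarefree_monomial S, x - squarefree_monomial S)"], goal_cases)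
  case (1 ab)
  then show ?case by (auto simp: splittings_def squarefree_monomial_keys)
next
  case (2 ab)
  then show ?case by (auto simp: splittings_def in_keys_iff lookup_add)
next
  case (3 S)
  then have "finite S" by (meson Pow_iff finite_keys finite_subset)
  then show ?case by (simp add: keys_squarefree_monomial)
next
  case (4 S)
  then have "finite S" by (meson Pow_iff finite_keys finite_subset)
  with 4 show ?case
    by (auto simp: splittings_def squarefree_monomial_plus_minus lookup_squarefree_monomial)
next
  case (5 ab)
  then show ?case by (auto simp: splittings_def squarefree_monomial_keys)
qed

section \<open>Signed sums over subsets and the convolution identity\<close>

lemma sum_Pow_insert:
  assumes "finite A" "i \<notin> A"
  shows "sum f (Pow (insert i A)) = (\<Sum>S\<in>Pow A. f S + f (insert i S))"
proof -
  have "inj_on (insert i) (Pow A)" using assms(2) by (auto simp: inj_on_def)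
  moreover have "Pow A \<inter> insert i ` Pow A = {}" using assms(2) by auto
  ultimately show ?thesis
    using assms(1) by (simp add: Pow_insert sum.union_disjoint sum.reindex sum.distrib)
qed

text \<open>All contributing \<open>S\<close> have size \<open>card K - r\<close>, so the sign is
  constant and only their number matters. For \<open>r > card K\<close> the exponent is truncated,
  but both sides are 0.\<close>

lemma sum_signed_subsets:
  assumes "finite K"
  shows "(\<Sum>S\<in>Pow K. if card (K - S) = r then (-1) ^ card S else 0 :: 'a::comm_ring_1) =
    (-1) ^ (card K - r) * of_nat (card K choose r)"
proof (cases "r \<le> card K")
  case True
  have eq: "{S \<in> Pow K. card (K - S) = r} = {S. S \<subseteq> K \<and> card S = card K - r}"
  proof (intro Collect_cong)
    fix S
    show "S \<in> Pow K \<and> card (K - S) = r \<longleftrightarrow> S \<subseteq> K \<and> card S = card K - r"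
      using True card_mono[OF assms, of S] card_Diff_subset[of S K] finite_subset[OF _ assms, of S]
      by auto
  qed
  have "(\<Sum>S\<in>Pow K. if card (K - S) = r then (-1) ^ card S else 0 :: 'a) =
      (\<Sum>S\<in>{S \<in> Pow K. card (K - S) = r}. (-1) ^ card S)"
    using assms by (subst sum.inter_filter) auto
  also have "\<dots> = (\<Sum>S\<in>{S. S \<subseteq> K \<and> card S = card K - r}. (-1) ^ (card K - r))"
    unfolding eq by (rule sum.cong) auto
  also have "\<dots> = (-1) ^ (card K - r) * of_nat (card K choose r)"
    using assms True by (simp add: n_subsets binomial_symmetric[OF True] mult.commute)
  finally show ?thesis .
next
  case False
  then have "card (K - S) \<noteq> r" for S using card_mono[OF assms, of "K - S"] by auto
  with False show ?thesis by (simp add: binomial_eq_0)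
qed

text \<open>Here \<open>S\<close> is the support of the factor taken from an elementary function.
  For squarefree \<open>x\<close>, removing \<open>S\<close> leaves the support complement and
  \<open>sum_signed_subsets\<close> applies; otherwise the terms cancel in pairs.\<close>

lemma sum_signed_squarefree_splittings:
  "(\<Sum>S\<in>Pow (Poly_Mapping.keys x).
      if card (Poly_Mapping.keys (x - squarefree_monomial S)) = r then (-1) ^ card S else 0 :: 'a::comm_ring_1) =
   (if \<forall>i. Poly_Mapping.lookup x i \<le> 1 then
      (-1) ^ (total_degree x - r) * of_nat (total_degree x choose r) else 0)"
proof (cases "\<forall>i. Poly_Mapping.lookup x i \<le> 1")
  case True
  let ?K = "Poly_Mapping.keys x"
  have "Poly_Mapping.keys (x - squarefree_monomial S) = ?K - S" if "S \<subseteq> ?K" for S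
  proof -
    have "finite S" by (rule finite_subset[OF that finite_keys])
    with True show ?thesis
      by (auto simp: in_keys_iff lookup_minus lookup_squarefree_monomial not_le le_Suc_eq split: if_splits)
  qed
  then have "(\<Sum>S\<in>Pow ?K. if card (Poly_Mapping.keys (x - squarefree_monomial S)) = r then (-1) ^ card S else 0 :: 'a) =
      (\<Sum>S\<in>Pow ?K. if card (?K - S) = r then (-1) ^ card S else 0)"
    by (intro sum.cong) auto
  moreover have "total_degree x = card ?K"
    using True by (metis finite_keys squarefree_monomial_keys total_degree_squarefree_monomial)
  ultimately show ?thesis using True by (simp add: sum_signed_subsets)
next
  case False
  let ?K = "Poly_Mapping.keys x"
  from False obtain i where i: "Poly_Mapping.lookup x i > 1" by (meson not_le)
  let ?A = "?K - {i}"
  have K: "?K = insert i ?A" using i by (auto simp: in_keys_iff)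
  txt \<open>Toggling an index of exponent at least 2 keeps the support of the complementary monomial.\<close>
  have "Poly_Mapping.keys (x - squarefree_monomial (insert i S)) = Poly_Mapping.keys (x - squarefree_monomial S)"
    "finite S" "i \<notin> S" if "S \<in> Pow ?A" for S
  proof -
    show "finite S" using that by (meson Pow_iff finite_Diff finite_keys finite_subset)
    moreover show "i \<notin> S" using that by auto
    ultimately show "Poly_Mapping.keys (x - squarefree_monomial (insert i S)) = Poly_Mapping.keys (x - squarefree_monomial S)"
      using i by (auto simp: in_keys_iff lookup_minus lookup_squarefree_monomial split: if_splits)
  qed
  then have "(\<Sum>S\<in>Pow (insert i ?A).
      if card (Poly_Mapping.keys (x - squarefree_monomial S)) = r then (-1) ^ card S else 0 :: 'a) = 0"
    by (subst sum_Pow_insert) (auto intro!: sum.neutral)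
  then show ?thesis unfolding K[symmetric] by (simp only: False if_False)
qed

text \<open>
  The coefficient of \<open>t\<^sup>n u\<^sup>r\<close> in
  \<open>E(-t) \<Prod>\<^sub>i (1 + u x\<^sub>i t / (1 - x\<^sub>i t)) = E((u - 1) t)\<close>, where \<open>E(t) = \<Sum>\<^sub>n e\<^sub>n t\<^sup>n\<close>.
\<close>

lemma sf_elementary_p_convolution:
  "(\<Sum>k\<le>n. sf_scale ((-1) ^ k) (sf_elementary k * sf_p (n - k) r)) =
   sf_scale ((-1) ^ (n - r) * of_nat (n choose r)) (sf_elementary n :: 'a::comm_ring_1 symfun)"
proof (rule symfun_eqI)
  fix x :: monomial
  let ?sqf = "\<lambda>a :: monomial. \<forall>i. Poly_Mapping.lookup a i \<le> 1"
  let ?c = "\<lambda>b :: monomial. card (Poly_Mapping.keys b)"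
  have "sf_coeff (\<Sum>k\<le>n. sf_scale ((-1) ^ k) (sf_elementary k * sf_p (n - k) r :: 'a symfun)) x =
      (\<Sum>k\<le>n. \<Sum>(a, b)\<in>splittings x.
        if ?sqf a \<and> ?c b = r \<and> total_degree a = k \<and> total_degree b = n - k then (-1) ^ k else 0)"
    by (simp add: sf_coeff_sum sf_scale.rep_eq times_symfun.rep_eq sum_distrib_left)
      (intro sum.cong refl, auto simp: sf_coeff_elementary sf_coeff_p)
  also have "\<dots> = (\<Sum>(a, b)\<in>splittings x. \<Sum>k\<le>n.
        if ?sqf a \<and> ?c b = r \<and> total_degree a = k \<and> total_degree b = n - k then (-1) ^ k else 0)"
    by (subst sum.swap) (simp add: case_prod_unfold)
  also have "\<dots> = (\<Sum>(a, b)\<in>splittings x.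
        if ?sqf a \<and> ?c b = r \<and> total_degree x = n then (-1) ^ total_degree a else 0)"
  proof (intro sum.cong refl, clarify)
    fix a b assume "(a, b) \<in> splittings x"
    then have d: "total_degree x = total_degree a + total_degree b"
      by (auto simp: splittings_def total_degree_add)
    \<comment> \<open>Degrees add along a splitting, so the only index that can contribute is
      \<open>k = total_degree a\<close>.\<close>
    have "(\<Sum>k\<le>n. if ?sqf a \<and> ?c b = r \<and> total_degree a = k \<and> total_degree b = n - k then (-1) ^ k else 0 :: 'a) =
      (\<Sum>k\<le>n. if k = total_degree a then
         if ?sqf a \<and> ?c b = r \<and> total_degree x = n then (-1) ^ total_degree a else 0 else 0)"
      using d by (intro sum.cong) auto
    also have "\<dots> = (if ?sqf a \<and> ?c b = r \<and> total_degree x = n then (-1) ^ total_degree a else 0)"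
      using d by auto
    finally show "(\<Sum>k\<le>n. if ?sqf a \<and> ?c b = r \<and> total_degree a = k \<and> total_degree b = n - k then (-1) ^ k else 0 :: 'a) =
      (if ?sqf a \<and> ?c b = r \<and> total_degree x = n then (-1) ^ total_degree a else 0)" .
  qed
  also have "\<dots> = (\<Sum>(a, b)\<in>{(a, b) \<in> splittings x. ?sqf a}.
        if ?c b = r \<and> total_degree x = n then (-1) ^ total_degree a else 0)"
    by (rule sum.mono_neutral_cong_right) (auto simp: finite_splittings split: if_splits)
  also have "\<dots> = (\<Sum>S\<in>Pow (Poly_Mapping.keys x).
        if ?c (x - squarefree_monomial S) = r \<and> total_degree x = n then (-1) ^ card S else 0)"
    unfolding sum_splittings_squarefree
    by (intro sum.cong refl) (auto simp: total_degree_squarefree_monomial finite_subset[OF _ finite_keys])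
  also have "\<dots> = (if total_degree x = n then \<Sum>S\<in>Pow (Poly_Mapping.keys x).
        if ?c (x - squarefree_monomial S) = r then (-1) ^ card S else 0 else 0)"
    by simp
  also have "\<dots> = sf_coeff (sf_scale ((-1) ^ (n - r) * of_nat (n choose r)) (sf_elementary n)) x"
    unfolding sum_signed_squarefree_splittings
    by (auto simp: sf_scale.rep_eq sf_coeff_elementary)
  finally show "sf_coeff (\<Sum>k\<le>n. sf_scale ((-1) ^ k) (sf_elementary k * sf_p (n - k) r :: 'a symfun)) x =
      sf_coeff (sf_scale ((-1) ^ (n - r) * of_nat (n choose r)) (sf_elementary n)) x" .
qed

section \<open>Degenerate cases and generating functions under a homomorphism\<close>

lemma sf_elementary_0: "sf_elementary 0 = 1"
proof (rule symfun_eqI)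
  fix x
  have "total_degree x = 0 \<longleftrightarrow> x = 0"
    by (auto simp: total_degree_def in_keys_iff intro: poly_mapping_eqI)
  then show "sf_coeff (sf_elementary 0) x = sf_coeff (1 :: 'a symfun) x"
    by (simp add: sf_coeff_elementary one_symfun.rep_eq)
qed

lemma sf_p_0_0: "sf_p 0 0 = 1"
  by (rule symfun_eqI) (auto simp: sf_coeff_p one_symfun.rep_eq)

lemma sf_p_eq_0: "n < r \<Longrightarrow> sf_p n r = 0"
proof (rule symfun_eqI)
  fix x assume "n < r"
  moreover have "card (Poly_Mapping.keys x) \<le> total_degree x"
    unfolding total_degree_def card_eq_sum by (intro sum_mono) (auto simp: in_keys_iff)
  ultimately show "sf_coeff (sf_p n r) x = sf_coeff (0 :: 'a symfun) x"
    by (auto simp: sf_coeff_p zero_symfun.rep_eq)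
qed

lemma sf_p_no_parts: "n > 0 \<Longrightarrow> sf_p n 0 = 0"
  by (intro symfun_eqI) (auto simp: sf_coeff_p zero_symfun.rep_eq)

lemma sf_algebra_hom_0: "sf_algebra_hom \<phi> \<Longrightarrow> \<phi> 0 = 0"
  unfolding sf_algebra_hom_def by (metis add_cancel_left_left)

lemma sf_algebra_hom_sum: "sf_algebra_hom \<phi> \<Longrightarrow> \<phi> (sum f A) = (\<Sum>a\<in>A. \<phi> (f a))"
  by (induction A rule: infinite_finite_induct) (simp_all add: sf_algebra_hom_0, simp add: sf_algebra_hom_def)

lemma sf_algebra_hom_convolution:
  assumes "sf_algebra_hom \<phi>"
  shows "(\<Sum>k\<le>n. (-1) ^ k * \<phi> (sf_elementary k) * \<phi> (sf_p (n - k) r)) =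
    (-1) ^ (n - r) * of_nat (n choose r) * \<phi> (sf_elementary n)"
  using arg_cong[OF sf_elementary_p_convolution[of n r], of \<phi>] assms
  by (simp add: sf_algebra_hom_sum) (simp add: sf_algebra_hom_def mult.assoc)

text \<open>The image of E(-t), the denominator of the generating function.\<close>

definition elementary_fps :: "('a::comm_ring_1 symfun \<Rightarrow> 'a) \<Rightarrow> 'a fps" where
  "elementary_fps \<phi> = Abs_fps (\<lambda>k. (-1) ^ k * \<phi> (sf_elementary k))"

lemma elementary_fps_mult_p:
  assumes "sf_algebra_hom \<phi>"
  shows "elementary_fps \<phi> * Abs_fps (\<lambda>n. \<phi> (sf_p n r)) =
    Abs_fps (\<lambda>n. (-1) ^ (n - r) * of_nat (n choose r) * \<phi> (sf_elementary n))"
  using sf_algebra_hom_convolution[OF assms]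
  by (intro fps_ext) (simp add: elementary_fps_def fps_mult_nth atLeast0AtMost)

text \<open>This is the generating function identity with u evaluated at \<open>z\<close>: weighting
  the convolution identities by \<open>z ^ j\<close> and summing over \<open>j\<close> produces the
  binomial expansion of \<open>(z - 1) ^ n\<close>.\<close>

lemma elementary_fps_mult_p_sum:
  assumes "sf_algebra_hom \<phi>"
  shows "elementary_fps \<phi> * Abs_fps (\<lambda>n. \<Sum>j\<le>n. z ^ j * \<phi> (sf_p n j)) =
    Abs_fps (\<lambda>n. (z - 1) ^ n * \<phi> (sf_elementary n))"
proof (rule fps_ext)
  fix n
  have "(elementary_fps \<phi> * Abs_fps (\<lambda>n. \<Sum>j\<le>n. z ^ j * \<phi> (sf_p n j))) $ n =
      (\<Sum>k\<le>n. (-1) ^ k * \<phi> (sf_elementary k) * (\<Sum>j\<le>n - k. z ^ j * \<phi> (sf_p (n - k) j)))"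
    by (simp add: elementary_fps_def fps_mult_nth atLeast0AtMost)
  \<comment> \<open>The inner range is extended to \<open>j \<le> n\<close>, where the new terms
    vanish by \<open>sf_p_eq_0\<close>; independent ranges allow the sums to be
    interchanged.\<close>
  also have "\<dots> = (\<Sum>k\<le>n. (-1) ^ k * \<phi> (sf_elementary k) * (\<Sum>j\<le>n. z ^ j * \<phi> (sf_p (n - k) j)))"
    by (intro sum.cong arg_cong2[where f = "(*)"] refl sum.mono_neutral_left) (auto simp: sf_p_eq_0 sf_algebra_hom_0[OF assms])
  also have "\<dots> = (\<Sum>j\<le>n. z ^ j * (\<Sum>k\<le>n. (-1) ^ k * \<phi> (sf_elementary k) * \<phi> (sf_p (n - k) j)))"
    by (simp add: sum_distrib_left, subst sum.swap, simp add: mult_ac)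
  also have "\<dots> = (\<Sum>j\<le>n. of_nat (n choose j) * z ^ j * (-1) ^ (n - j)) * \<phi> (sf_elementary n)"
    unfolding sf_algebra_hom_convolution[OF assms] sum_distrib_right by (simp add: mult_ac)
  also have "(\<Sum>j\<le>n. of_nat (n choose j) * z ^ j * (-1) ^ (n - j)) = (z - 1) ^ n"
    using binomial_ring[of z "-1" n] by simp
  finally show "(elementary_fps \<phi> * Abs_fps (\<lambda>n. \<Sum>j\<le>n. z ^ j * \<phi> (sf_p n j))) $ n =
      Abs_fps (\<lambda>n. (z - 1) ^ n * \<phi> (sf_elementary n)) $ n" by simp
qed

section \<open>The specialized series and the recurrence\<close>

text \<open>The mixed term \<open>m * n\<close> is what turns t into \<open>q ^ r\<close> t in the
  specialized series; the same identity later governs the degrees.\<close>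

lemma choose_two_add: "(m + n) choose 2 = (m choose 2) + (n choose 2) + m * n"
  by (induction m) (simp_all add: numeral_2_eq_2)

lemma one_minus_q_power: "1 - q ^ r = (1 - q) * q_int r"
  by (simp add: q_int_def one_diff_power_eq)

lemma q_neq_0: "q \<noteq> 0"
  by (simp add: q_def)

lemma q_neq_1: "q \<noteq> 1"
proof -
  have "[:0, 1 :: rat:] \<noteq> 1" by (simp add: one_pCons)
  then show ?thesis unfolding q_def by (metis to_fract_1 to_fract_eq_iff)
qed

context
  fixes \<phi> :: "ratfun symfun \<Rightarrow> ratfun"
  assumes hom: "sf_algebra_hom \<phi>"
    and spec: "\<And>n. n \<ge> 1 \<Longrightarrow> \<phi> (sf_elementary n) = q ^ (n choose 2) / fact n"
begin

lemma phi_elementary: "\<phi> (sf_elementary n) = q ^ (n choose 2) / fact n"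
  using spec[of n] hom by (cases n) (auto simp: sf_elementary_0 sf_algebra_hom_def binomial_eq_0)

text \<open>At \<open>z = 1 - q ^ r\<close> one has \<open>(z - 1) ^ n = (- (q ^ r)) ^ n\<close>.
  Hence, up to the prefactor and the shift by \<open>r\<close>, both sides have the same product
  with \<open>elementary_fps \<phi>\<close>, which can be cancelled.\<close>

lemma phi_p_shift:
  "\<phi> (sf_p (m + r) r) = q ^ (r choose 2) / fact r * (\<Sum>j\<le>m. (1 - q ^ r) ^ j * \<phi> (sf_p m j))"
proof -
  let ?c = "q ^ (r choose 2) / fact r"
  let ?P = "Abs_fps (\<lambda>n. \<phi> (sf_p n r))"
  let ?Z = "Abs_fps (\<lambda>n. \<Sum>j\<le>n. (1 - q ^ r) ^ j * \<phi> (sf_p n j))"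
  have "(-1) ^ (n - r) * of_nat (n choose r) * \<phi> (sf_elementary n) =
      (if n < r then 0 else ?c * (- (q ^ r)) ^ (n - r) * \<phi> (sf_elementary (n - r)))" for n
  proof (cases "n < r")
    case False
    then obtain k where n: "n = k + r" by (metis add.commute le_add_diff_inverse not_less)
    have "(of_nat (n choose r) :: ratfun) = fact n / (fact r * fact k)"
      by (subst binomial_fact) (simp_all add: n)
    moreover have "(- (q ^ r)) ^ k = (-1) ^ k * q ^ (k * r)"
      by (metis mult.commute power_minus power_mult)
    \<comment> \<open>Here \<open>N\<close>, \<open>R\<close>, \<open>K\<close> stand for the
      factorials of \<open>n\<close>, \<open>r\<close>, \<open>k\<close>, \<open>s\<close> for the
      sign, and \<open>x\<close>, \<open>y\<close>, \<open>z\<close> for the powers of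
      \<open>q\<close> with exponents \<open>k choose 2\<close>, \<open>r choose 2\<close>,
      \<open>k * r\<close>.\<close>
    moreover have "s * (N / (R * K)) * (x * y * z / N) = y / R * (s * z) * (x / K)" if "N \<noteq> 0"
      for s N R K x y z :: ratfun
      using that by simp
    ultimately show ?thesis
      by (simp add: phi_elementary n choose_two_add power_add)
  qed (simp add: binomial_eq_0)
  then have "elementary_fps \<phi> * ?P = elementary_fps \<phi> * (fps_X ^ r * (fps_const ?c * ?Z))"
    unfolding elementary_fps_mult_p[OF hom]
    unfolding mult.left_commute[of "elementary_fps \<phi>"] elementary_fps_mult_p_sum[OF hom]
    by (intro fps_ext) (auto simp: fps_X_power_mult_nth mult.assoc)
  \<comment> \<open>The constant term is 1, so the series is nonzero and cancels in the integral
    domain of power series.\<close>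
  moreover have "elementary_fps \<phi> $ 0 \<noteq> 0"
    by (simp add: elementary_fps_def phi_elementary)
  then have "elementary_fps \<phi> \<noteq> 0" by (metis fps_zero_nth)
  ultimately have "?P = fps_X ^ r * (fps_const ?c * ?Z)"
    unfolding mult_cancel_left by blast
  then have "?P $ (m + r) = (fps_X ^ r * (fps_const ?c * ?Z)) $ (m + r)" by (rule arg_cong)
  then show ?thesis by (simp add: fps_X_power_mult_nth)
qed

context
  fixes J :: "nat \<Rightarrow> nat \<Rightarrow> ratfun"
  assumes J: "\<And>n r. n \<ge> r \<Longrightarrow> r \<ge> 1 \<Longrightarrow>
      \<phi> (sf_p n r) = (1 - q) ^ (n - r) * (q ^ (r choose 2) / (fact r * fact (n - r))) * J n r"
begin

text \<open>The defining equation of \<open>J\<close> and \<open>phi_p_shift\<close> share the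
  nonzero prefactor \<open>q ^ (r choose 2) / fact r\<close>, which is cancelled.\<close>

lemma J_eq_phi_p_sum:
  assumes "r \<ge> 1"
  shows "(1 - q) ^ m * J (m + r) r = fact m * (\<Sum>j\<le>m. (1 - q ^ r) ^ j * \<phi> (sf_p m j))"
proof -
  have cancel: "a * x = f * s" if "c * s = a * (c / f) * x" "c \<noteq> 0" "f \<noteq> 0" for a c f s x :: ratfun
  proof -
    have "c * (f * s) = c * (a * x)" using that by (simp add: nonzero_eq_divide_eq mult_ac)
    with \<open>c \<noteq> 0\<close> show ?thesis by simp
  qed
  show ?thesis
  proof (rule cancel)
    show "q ^ (r choose 2) / fact r * (\<Sum>j\<le>m. (1 - q ^ r) ^ j * \<phi> (sf_p m j)) =
        (1 - q) ^ m * (q ^ (r choose 2) / fact r / fact m) * J (m + r) r"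
      using J[of r "m + r"] assms unfolding phi_p_shift by (simp only: le_add2 add_diff_cancel_right' divide_divide_eq_left)
    show "q ^ (r choose 2) / fact r \<noteq> 0" "(fact m :: ratfun) \<noteq> 0"
      using q_neq_0 by (simp_all only: divide_eq_0_iff power_eq_0_iff fact_nonzero simp_thms)
  qed
qed

lemma J_diag: "r \<ge> 1 \<Longrightarrow> J r r = 1"
  using J_eq_phi_p_sum[of r 0] hom by (simp add: sf_p_0_0 sf_algebra_hom_def)

text \<open>In the \<open>j\<close>-th summand, \<open>1 - q ^ r\<close> supplies
  \<open>(1 - q) ^ j\<close> and the definition of \<open>J m j\<close> supplies
  \<open>(1 - q) ^ (m - j)\<close>. The common factor \<open>(1 - q) ^ m\<close> cancels because
  \<open>q\<close> is not 1, and the factorials form the binomial coefficient.\<close>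

lemma J_recurrence:
  assumes "m \<ge> 1" "r \<ge> 1"
  shows "J (m + r) r = (\<Sum>j = 1..m. q_int r ^ j * q ^ (j choose 2) * of_nat (m choose j) * J m j)"
proof -
  \<comment> \<open>The term \<open>j = 0\<close> drops out, as no partition of
    \<open>m \<ge> 1\<close> has zero parts.\<close>
  have "(\<Sum>j\<le>m. (1 - q ^ r) ^ j * \<phi> (sf_p m j)) = (\<Sum>j = 1..m. (1 - q ^ r) ^ j * \<phi> (sf_p m j))"
    using assms hom
    by (intro sum.mono_neutral_right) (auto simp: not_le sf_p_no_parts sf_algebra_hom_0)
  also have "fact m * \<dots> = (1 - q) ^ m * (\<Sum>j = 1..m. q_int r ^ j * q ^ (j choose 2) * of_nat (m choose j) * J m j)"
    unfolding sum_distrib_left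
  proof (rule sum.cong[OF refl])
    fix j assume j: "j \<in> {1..m}"
    then have "(of_nat (m choose j) :: ratfun) = fact m / (fact j * fact (m - j))"
      by (simp add: binomial_fact)
    moreover have "(1 - q) ^ m = (1 - q) ^ j * (1 - q) ^ (m - j)"
      using j by (simp flip: power_add)
    ultimately show "fact m * ((1 - q ^ r) ^ j * \<phi> (sf_p m j)) =
        (1 - q) ^ m * (q_int r ^ j * q ^ (j choose 2) * of_nat (m choose j) * J m j)"
      using j J[of j m] by (simp add: one_minus_q_power power_mult_distrib mult_ac)
  qed
  finally show ?thesis using J_eq_phi_p_sum[OF assms(2), of m] q_neq_1 by simp
qed

end

end

section \<open>Natural coefficients and polynomial lifts from the fraction field\<close>

definition nat_coeffs :: "'a::semiring_1 poly \<Rightarrow> bool" where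
  "nat_coeffs p \<longleftrightarrow> (\<forall>i. coeff p i \<in> \<nat>)"

lemma Nats_sum: "(\<And>a. a \<in> A \<Longrightarrow> f a \<in> \<nat>) \<Longrightarrow> sum f A \<in> \<nat>"
  by (induction A rule: infinite_finite_induct) auto

lemma nat_coeffs_sum: "(\<And>a. a \<in> A \<Longrightarrow> nat_coeffs (f a)) \<Longrightarrow> nat_coeffs (sum f A)"
  by (auto simp: nat_coeffs_def coeff_sum intro!: Nats_sum)

lemma nat_coeffs_mult: "nat_coeffs p \<Longrightarrow> nat_coeffs r \<Longrightarrow> nat_coeffs (p * r)"
  for p r :: "'a::comm_semiring_1 poly"
  by (auto simp: nat_coeffs_def coeff_mult intro!: Nats_sum Nats_mult)

lemma nat_coeffs_monom_1: "nat_coeffs (monom 1 k)"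
  by (simp add: nat_coeffs_def)

lemma nat_coeffs_of_nat: "nat_coeffs (of_nat k :: 'a::comm_semiring_1 poly)"
  by (auto simp: nat_coeffs_def of_nat_poly coeff_pCons split: nat.splits)

lemma nat_coeffs_power: "nat_coeffs p \<Longrightarrow> nat_coeffs (p ^ k)"
  for p :: "'a::comm_semiring_1 poly"
  using nat_coeffs_of_nat[of 1] by (induction k) (auto intro: nat_coeffs_mult)

lemma to_fract_power: "to_fract (p ^ k) = to_fract p ^ k"
  by (induction k) simp_all

lemma to_fract_of_nat: "to_fract (of_nat k) = of_nat k"
  by (induction k) simp_all

lemma to_fract_monom_1: "to_fract (monom 1 k) = q ^ k"
  by (simp add: q_def monom_altdef to_fract_power)

text \<open>The lift of \<open>q_int\<close> to polynomials, where degrees and coefficients can be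
  read off.\<close>

definition q_int_poly :: "nat \<Rightarrow> rat poly" where
  "q_int_poly r = (\<Sum>i<r. monom 1 i)"

lemma to_fract_q_int_poly: "to_fract (q_int_poly r) = q_int r"
  by (simp add: q_int_poly_def q_int_def to_fract_monom_1)

lemma nat_coeffs_q_int_poly: "nat_coeffs (q_int_poly r)"
  unfolding q_int_poly_def by (intro nat_coeffs_sum nat_coeffs_monom_1)

lemma coeff_q_int_poly: "coeff (q_int_poly r) i = (if i < r then 1 else 0)"
  by (simp add: q_int_poly_def coeff_sum)

lemma degree_q_int_poly: "degree (q_int_poly r) = r - 1"
proof (cases r)
  case 0
  then show ?thesis by (simp add: q_int_poly_def)
next
  case (Suc k)
  then show ?thesis
    by (intro antisym degree_le le_degree) (auto simp: coeff_q_int_poly)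
qed

lemma lead_coeff_q_int_poly: "r \<ge> 1 \<Longrightarrow> lead_coeff (q_int_poly r) = 1"
  by (simp add: degree_q_int_poly coeff_q_int_poly)

section \<open>Degrees, leading and constant coefficients by induction\<close>

text \<open>With \<open>k = m - j\<close>, the right side exceeds the left by exactly
  \<open>k * r\<close>. The left side is the degree of the \<open>j\<close>-th summand of the
  recurrence, the right side that of the summand \<open>j = m\<close>.\<close>

lemma recurrence_summand_degree_less:
  fixes j m r :: nat
  assumes "1 \<le> j" "j < m" "r \<ge> 1"
  shows "j * (r - 1) + (j choose 2) + (((m - j) choose 2) + (m - j) * (j - 1)) < (m choose 2) + m * (r - 1)"
proof -
  obtain k where m: "m = k + j" and "k > 0" using assms by (metis less_imp_add_positive add.commute)
  obtain i where j: "j = Suc i" using assms by (cases j) auto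
  obtain s where r: "r = Suc s" using assms by (cases r) auto
  show ?thesis using \<open>k > 0\<close> unfolding m choose_two_add by (simp add: j r algebra_simps)
qed

text \<open>The inductive step, with \<open>Q j\<close> in the role of \<open>J m j\<close>. Above
  and at the claimed degree only the summand \<open>j = m\<close> has nonzero coefficients, which
  settles degree and leading coefficient.\<close>

lemma J_poly_step:
  fixes Q :: "nat \<Rightarrow> rat poly"
  assumes "m \<ge> 1" "r \<ge> 1"
    and monic: "\<And>j. j \<in> {1..m} \<Longrightarrow> lead_coeff (Q j) = 1"
    and nat: "\<And>j. j \<in> {1..m} \<Longrightarrow> nat_coeffs (Q j)"
    and const: "\<And>j. j \<in> {1..m} \<Longrightarrow> coeff (Q j) 0 = fact (m - j)"
    and deg: "\<And>j. j \<in> {1..m} \<Longrightarrow> degree (Q j) = ((m - j) choose 2) + (m - j) * (j - 1)"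
  defines "P \<equiv> \<Sum>j = 1..m. q_int_poly r ^ j * monom 1 (j choose 2) * of_nat (m choose j) * Q j"
  shows "lead_coeff P = 1" "nat_coeffs P" "coeff P 0 = fact m"
    "degree P = (m choose 2) + m * (r - 1)"
proof -
  let ?T = "\<lambda>j. q_int_poly r ^ j * monom 1 (j choose 2) * of_nat (m choose j) * Q j"
  let ?D = "(m choose 2) + m * (r - 1)"
  have nz: "q_int_poly r \<noteq> 0" using lead_coeff_q_int_poly[OF assms(2)] by auto
  have Qnz: "Q m \<noteq> 0" using monic[of m] assms(1) by auto
  have top_deg: "degree (?T m) = ?D"
    using nz Qnz assms(1) deg[of m]
    by (simp add: degree_mult_eq degree_power_eq degree_monom_eq degree_q_int_poly binomial_eq_0)
  have "lead_coeff (?T m) = 1"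
    using assms(1) monic[of m] lead_coeff_q_int_poly[OF assms(2)]
    by (simp add: lead_coeff_mult lead_coeff_power degree_monom_eq)
  then have top: "coeff (?T m) ?D = 1" by (simp only: top_deg)
  have low: "coeff (?T j) i = 0" if "j \<in> {1..m}" "j \<noteq> m" "i \<ge> ?D" for i j
  proof (rule coeff_eq_0)
    have "degree (?T j) \<le> degree (q_int_poly r ^ j) + degree (monom (1 :: rat) (j choose 2)) +
        degree (of_nat (m choose j) :: rat poly) + degree (Q j)"
      by (meson add_mono degree_mult_le order_refl order_trans)
    also have "\<dots> = j * (r - 1) + (j choose 2) + (((m - j) choose 2) + (m - j) * (j - 1))"
      using nz deg[OF that(1)] by (simp add: degree_power_eq degree_monom_eq degree_q_int_poly)
    also have "\<dots> < ?D" using that assms by (intro recurrence_summand_degree_less) auto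
    finally show "degree (?T j) < i" using that(3) by simp
  qed
  have high: "coeff P i = coeff (?T m) i" if "i \<ge> ?D" for i
  proof -
    have "coeff P i = (\<Sum>j = 1..m. coeff (?T j) i)" by (simp add: P_def coeff_sum)
    also have "\<dots> = (\<Sum>j\<in>{m}. coeff (?T j) i)"
      using assms(1) low that by (intro sum.mono_neutral_right) auto
    finally show ?thesis by simp
  qed
  have cD: "coeff P ?D = 1" using high[of ?D] top by simp
  show d: "degree P = ?D"
  proof (rule antisym)
    show "degree P \<le> ?D" using high top_deg by (intro degree_le) (simp add: coeff_eq_0)
    show "?D \<le> degree P" using cD by (intro le_degree) simp
  qed
  with cD show "lead_coeff P = 1" by simp
  show "nat_coeffs P" unfolding P_def
    by (intro nat_coeffs_sum nat_coeffs_mult nat_coeffs_power nat_coeffs_q_int_poly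
        nat_coeffs_monom_1 nat_coeffs_of_nat nat)
  have q0: "poly (q_int_poly r) 0 = 1" using assms(2) by (simp add: poly_0_coeff_0 coeff_q_int_poly)
  \<comment> \<open>The constant term is the value at 0, where \<open>q_int_poly r\<close> is 1. The
    factor \<open>0 ^ (j choose 2)\<close> vanishes for \<open>j \<ge> 2\<close> and is
    \<open>0 ^ 0 = 1\<close> for \<open>j = 1\<close>, leaving \<open>m\<close> times
    \<open>fact (m - 1)\<close>.\<close>
  have "poly P 0 = (\<Sum>j = 1..m. 0 ^ (j choose 2) * of_nat (m choose j) * fact (m - j))"
    using const by (simp add: P_def poly_sum poly_monom q0 poly_0_coeff_0[of "Q _"])
  also have "\<dots> = (\<Sum>j\<in>{1}. 0 ^ (j choose 2) * of_nat (m choose j) * fact (m - j))"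
    using assms(1) by (intro sum.mono_neutral_right) (auto simp: zero_power)
  also have "\<dots> = fact m" using assms(1) by (simp add: fact_reduce[of m] binomial_eq_0)
  finally show "coeff P 0 = fact m" by (simp add: poly_0_coeff_0)
qed

text \<open>Strong induction on the difference \<open>m\<close> of the two indices, for all
  \<open>r\<close> at once: the recurrence calls \<open>J m j\<close>, whose difference
  \<open>m - j\<close> is smaller since \<open>j \<ge> 1\<close>. The degree is written free of
  subtracted binomials.\<close>

lemma J_poly:
  fixes J :: "nat \<Rightarrow> nat \<Rightarrow> ratfun"
  assumes diag: "\<And>r. r \<ge> 1 \<Longrightarrow> J r r = 1"
    and rec: "\<And>m r. m \<ge> 1 \<Longrightarrow> r \<ge> 1 \<Longrightarrow>
      J (m + r) r = (\<Sum>j = 1..m. q_int r ^ j * q ^ (j choose 2) * of_nat (m choose j) * J m j)"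
    and "r \<ge> 1"
  shows "\<exists>P. J (m + r) r = to_fract P \<and> lead_coeff P = 1 \<and> nat_coeffs P \<and>
    coeff P 0 = fact m \<and> degree P = (m choose 2) + m * (r - 1)"
  using \<open>r \<ge> 1\<close>
proof (induction m arbitrary: r rule: less_induct)
  case (less m)
  show ?case
  proof (cases "m = 0")
    case True
    then show ?thesis using diag less.prems nat_coeffs_of_nat[of 1] by (intro exI[of _ 1]) simp
  next
    case False
    have "\<forall>j\<in>{1..m}. \<exists>P. J m j = to_fract P \<and> lead_coeff P = 1 \<and> nat_coeffs P \<and>
        coeff P 0 = fact (m - j) \<and> degree P = ((m - j) choose 2) + (m - j) * (j - 1)"
    proof
      fix j assume "j \<in> {1..m}"
      then show "\<exists>P. J m j = to_fract P \<and> lead_coeff P = 1 \<and> nat_coeffs P \<and>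
        coeff P 0 = fact (m - j) \<and> degree P = ((m - j) choose 2) + (m - j) * (j - 1)"
        using less.IH[of "m - j" j] by simp
    qed
    from bchoice[OF this] obtain Q where Q: "\<forall>j\<in>{1..m}. J m j = to_fract (Q j) \<and> lead_coeff (Q j) = 1 \<and>
        nat_coeffs (Q j) \<and> coeff (Q j) 0 = fact (m - j) \<and>
        degree (Q j) = ((m - j) choose 2) + (m - j) * (j - 1)" by blast
    let ?P = "\<Sum>j = 1..m. q_int_poly r ^ j * monom 1 (j choose 2) * of_nat (m choose j) * Q j"
    have "J (m + r) r = to_fract ?P"
      using rec[of m r] less.prems False Q
      by (simp add: to_fract_power to_fract_of_nat to_fract_monom_1 to_fract_q_int_poly)
    moreover have "lead_coeff ?P = 1 \<and> nat_coeffs ?P \<and> coeff ?P 0 = fact m \<and>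
        degree ?P = (m choose 2) + m * (r - 1)"
      by (intro conjI J_poly_step) (use Q False less.prems in \<open>blast | simp\<close>)+
    ultimately show ?thesis by blast
  qed
qed

theorem theorem6p3:
  fixes \<phi> :: "ratfun symfun \<Rightarrow> ratfun"
    and J :: "nat \<Rightarrow> nat \<Rightarrow> ratfun"
  assumes hom: "sf_algebra_hom \<phi>"
    and spec: "\<And>n. n \<ge> 1 \<Longrightarrow> \<phi> (sf_elementary n) = q ^ (n choose 2) / fact n"
    and J: "\<And>n r. n \<ge> r \<Longrightarrow> r \<ge> 1 \<Longrightarrow>
      \<phi> (sf_p n r) = (1 - q) ^ (n - r) * (q ^ (r choose 2) / (fact r * fact (n - r))) * J n r"
  shows "(\<forall>n r. n \<ge> r \<and> r \<ge> 1 \<longrightarrow>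
            (\<exists>P :: rat poly. J n r = to_fract P \<and> lead_coeff P = 1 \<and> (\<forall>i. coeff P i \<in> \<nat>) \<and>
               coeff P 0 = fact (n - r) \<and>
               int (degree P) = int ((n - 1) choose 2) - int ((r - 1) choose 2))) \<and>
         (\<forall>r \<ge> 1. J r r = 1) \<and>
         (\<forall>n r. n - 1 \<ge> r \<and> r \<ge> 1 \<longrightarrow>
            J n r = (\<Sum>j = 1..n - r.
              q_int r ^ j * q ^ (j choose 2) * of_nat ((n - r) choose j) * J (n - r) j))"
proof (intro conjI allI impI; (elim conjE)?)
  have diag: "J r r = 1" if "r \<ge> 1" for r
    by (rule J_diag[OF hom]) (fact spec J that)+
  have rec: "J (m + r) r = (\<Sum>j = 1..m. q_int r ^ j * q ^ (j choose 2) * of_nat (m choose j) * J m j)"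
    if "m \<ge> 1" "r \<ge> 1" for m r
    by (rule J_recurrence[OF hom]) (fact spec J that)+
  fix n r :: nat
  {
    assume "r \<le> n" "1 \<le> r"
    \<comment> \<open>The second equation lets \<open>choose_two_add\<close> expand
      \<open>(n - 1) choose 2\<close>, so that subtracting \<open>(r - 1) choose 2\<close> leaves
      the degree given by \<open>J_poly\<close>.\<close>
    then have n: "n - r + r = n" "n - 1 = n - r + (r - 1)" by auto
    have "\<exists>P. J (n - r + r) r = to_fract P \<and> lead_coeff P = 1 \<and> nat_coeffs P \<and>
        coeff P 0 = fact (n - r) \<and> degree P = ((n - r) choose 2) + (n - r) * (r - 1)"
      by (rule J_poly) (fact diag rec \<open>1 \<le> r\<close>)+
    then obtain P where "J n r = to_fract P" "lead_coeff P = 1" "nat_coeffs P" "coeff P 0 = fact (n - r)"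
      "degree P = ((n - r) choose 2) + (n - r) * (r - 1)"
      unfolding n(1) by blast
    then show "\<exists>P :: rat poly. J n r = to_fract P \<and> lead_coeff P = 1 \<and> (\<forall>i. coeff P i \<in> \<nat>) \<and>
        coeff P 0 = fact (n - r) \<and>
        int (degree P) = int ((n - 1) choose 2) - int ((r - 1) choose 2)"
      unfolding n(2) choose_two_add by (intro exI[of _ P]) (simp add: nat_coeffs_def)
  next
    assume "1 \<le> r"
    then show "J r r = 1" by (rule diag)
  next
    assume "r \<le> n - 1" "1 \<le> r"
    then show "J n r = (\<Sum>j = 1..n - r.
        q_int r ^ j * q ^ (j choose 2) * of_nat ((n - r) choose j) * J (n - r) j)"
      using rec[of "n - r" r] by simp
  }
qed

end
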